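(* For every $\epsilon>0$ there exist a connected graph $G$ and an edge-weight function $\omega: E(G)\to\mathbb{R}_{\geq 0}$ with $\omega(G)>0$ such that $$\frac{t_\omega(G)}{u(G)}<\epsilon .$$
   Context: Graphs are finite, simple and undirected. For a connected graph $G$ and a function $\omega:E(G)\to\mathbb{R}_{\ge 0}$, write $\omega(H)=\sum_{e\in E(H)}\omega(e)$ for a subgraph $H$ and $\omega(G)=\sum_{e\in E(G)}\omega(e)$. Let $T_\omega$ be a maximum spanning tree of $G$ with respect to $\omega$, i.e. a spanning tree maximizing $\omega(T)$. When $\omega(G)>0$, the weighting ratio is $t_\omega(G)=\omega(T_\omega)/\omega(G)$; it does not depend on the choice of $T_\omega$. The uniform ratio is $u(G)=\frac{|V(G)|-1}{|E(G)|}$, i.e. the weighting ratio when all edges have weight $1$. *)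

theory Defs
  imports Complex_Main "HOL-Library.Ramsey"
begin

text \<open>A finite simple undirected graph is given by its vertex set \<open>V\<close> and its set \<open>E\<close> of edges,
  each edge being a two-element subset of \<open>V\<close>.\<close>

definition simple_graph :: "'a set \<Rightarrow> 'a set set \<Rightarrow> bool" where
  "simple_graph V E \<longleftrightarrow> finite V \<and> E \<subseteq> [V]\<^bsup>2\<^esup>"

definition adjacency :: "'a set set \<Rightarrow> ('a \<times> 'a) set" where
  "adjacency E = {(u, v). {u, v} \<in> E}"

text \<open>By convention the graph without vertices is not connected.\<close>

definition connected_graph :: "'a set \<Rightarrow> 'a set set \<Rightarrow> bool" where
  "connected_graph V E \<longleftrightarrow>
     simple_graph V E \<and> V \<noteq> {} \<and> (\<forall>u\<in>V. \<forall>v\<in>V. (u, v) \<in> (adjacency E)\<^sup>*)"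

text \<open>A cycle is the list of its pairwise distinct vertices; the last one is adjacent to the
  first one.\<close>

definition is_cycle :: "'a set set \<Rightarrow> 'a list \<Rightarrow> bool" where
  "is_cycle E xs \<longleftrightarrow> 3 \<le> length xs \<and> distinct xs \<and>
     (\<forall>i<length xs. {xs ! i, xs ! (Suc i mod length xs)} \<in> E)"

definition is_tree :: "'a set \<Rightarrow> 'a set set \<Rightarrow> bool" where
  "is_tree V E \<longleftrightarrow> connected_graph V E \<and> (\<nexists>xs. is_cycle E xs)"

text \<open>A spanning tree has vertex set \<open>V\<close>, so it is given by its edge set \<open>T\<close>.\<close>

definition is_spanning_tree :: "'a set \<Rightarrow> 'a set set \<Rightarrow> 'a set set \<Rightarrow> bool" where
  "is_spanning_tree V E T \<longleftrightarrow> T \<subseteq> E \<and> is_tree V T"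

definition weight :: "('a set \<Rightarrow> real) \<Rightarrow> 'a set set \<Rightarrow> real" where
  "weight \<omega> F = (\<Sum>e\<in>F. \<omega> e)"

definition is_max_spanning_tree ::
  "'a set \<Rightarrow> 'a set set \<Rightarrow> ('a set \<Rightarrow> real) \<Rightarrow> 'a set set \<Rightarrow> bool" where
  "is_max_spanning_tree V E \<omega> T \<longleftrightarrow> is_spanning_tree V E T \<and>
     (\<forall>T'. is_spanning_tree V E T' \<longrightarrow> weight \<omega> T' \<le> weight \<omega> T)"

definition weighting_ratio :: "'a set \<Rightarrow> 'a set set \<Rightarrow> ('a set \<Rightarrow> real) \<Rightarrow> real" where
  "weighting_ratio V E \<omega> =
     weight \<omega> (SOME T. is_max_spanning_tree V E \<omega> T) / weight \<omega> E"

definition uniform_ratio :: "'a set \<Rightarrow> 'a set set \<Rightarrow> real" where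
  "uniform_ratio V E = (real (card V) - 1) / real (card E)"

lemma simple_graph_finite_edges:
  assumes "simple_graph V E"
  shows "finite E"
  using assms unfolding simple_graph_def
  by (metis finite_imp_finite_nsets finite_subset)

lemma sym_adjacency: "sym (adjacency E)"
  by (auto simp: adjacency_def sym_def insert_commute)

text \<open>Maximum spanning trees exist and the weighting ratio does not depend on the choice of one,
  so the description operator in \<open>weighting_ratio\<close> is harmless.\<close>

lemma connected_graph_remove_cycle_edge:
  assumes con: "connected_graph V T" and cyc: "is_cycle T xs"
  defines "e \<equiv> {last xs, hd xs}"
  shows "e \<in> T" and "connected_graph V (T - {e})"
proof -
  have len: "3 \<le> length xs" and dist: "distinct xs"
    and edge: "\<And>i. i < length xs \<Longrightarrow> {xs ! i, xs ! (Suc i mod length xs)} \<in> T"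
    using cyc by (auto simp: is_cycle_def)
  have ne: "xs \<noteq> []" using len by auto
  have e_eq: "e = {xs ! (length xs - 1), xs ! 0}"
    using ne by (simp add: e_def last_conv_nth hd_conv_nth)
  show "e \<in> T"
    using edge[of "length xs - 1"] ne by (simp add: e_eq)
  have step: "(xs ! i, xs ! Suc i) \<in> adjacency (T - {e})" if "Suc i < length xs" for i
  proof -
    have "{xs ! i, xs ! Suc i} \<in> T" using edge[of i] that by simp
    moreover have "{xs ! i, xs ! Suc i} \<noteq> e"
    proof
      assume "{xs ! i, xs ! Suc i} = e"
      then have "xs ! i = xs ! (length xs - 1) \<or> xs ! i = xs ! 0 \<and> xs ! Suc i = xs ! (length xs - 1)"
        by (auto simp: e_eq doubleton_eq_iff)
      then have "i = length xs - 1 \<or> i = 0 \<and> Suc i = length xs - 1"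
        using nth_eq_iff_index_eq[OF dist] that by (metis Suc_lessD diff_less ne length_greater_0_conv zero_less_one)
      then show False using that len by linarith
    qed
    ultimately show ?thesis by (simp add: adjacency_def)
  qed
  have "(xs ! 0, xs ! i) \<in> (adjacency (T - {e}))\<^sup>*" if "i < length xs" for i
    using that
  proof (induction i)
    case (Suc i)
    then show ?case using step[of i] by (meson Suc_lessD rtrancl.rtrancl_into_rtrancl)
  qed simp
  from this[of "length xs - 1"]
  have fwd: "(xs ! 0, xs ! (length xs - 1)) \<in> (adjacency (T - {e}))\<^sup>*"
    using ne by simp
  then have bwd: "(xs ! (length xs - 1), xs ! 0) \<in> (adjacency (T - {e}))\<^sup>*"
    by (meson sym_adjacency sym_rtrancl symD)
  have "adjacency T \<subseteq> (adjacency (T - {e}))\<^sup>*"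
  proof
    fix p assume p: "p \<in> adjacency T"
    obtain u v where uv: "p = (u, v)" by (cases p)
    show "p \<in> (adjacency (T - {e}))\<^sup>*"
    proof (cases "{u, v} = e")
      case True
      then show ?thesis using fwd bwd by (auto simp: uv e_eq doubleton_eq_iff)
    next
      case False
      then show ?thesis using p by (auto simp: uv adjacency_def)
    qed
  qed
  then have "(adjacency T)\<^sup>* \<subseteq> (adjacency (T - {e}))\<^sup>*"
    by (rule rtrancl_subset_rtrancl)
  then show "connected_graph V (T - {e})"
    using con by (auto simp: connected_graph_def simple_graph_def)
qed

lemma ex_spanning_tree:
  assumes "connected_graph V E"
  shows "\<exists>T. is_spanning_tree V E T"
proof -
  let ?P = "\<lambda>T. T \<subseteq> E \<and> connected_graph V T"
  have "?P E" using assms by simp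
  then obtain T where T: "?P T" and "\<forall>S. ?P S \<longrightarrow> card T \<le> card S"
    using ex_has_least_nat[of ?P E card] by blast
  then have min: "\<And>S. ?P S \<Longrightarrow> card T \<le> card S" by blast
  have finT: "finite T"
    using T simple_graph_finite_edges by (auto simp: connected_graph_def)
  have "\<not> is_cycle T xs" for xs
  proof
    assume cyc: "is_cycle T xs"
    let ?e = "{last xs, hd xs}"
    have "?e \<in> T" and "connected_graph V (T - {?e})"
      using connected_graph_remove_cycle_edge[of V T xs] T cyc by auto
    then have "card T \<le> card (T - {?e})" using min[of "T - {?e}"] T by blast
    then show False using \<open>?e \<in> T\<close> finT by (meson card_Diff1_less not_le)
  qed
  then show ?thesis using T by (auto simp: is_spanning_tree_def is_tree_def)
qed

lemma ex_max_spanning_tree: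
  assumes "connected_graph V E"
  shows "\<exists>T. is_max_spanning_tree V E \<omega> T"
proof -
  let ?S = "{T. is_spanning_tree V E T}"
  have "finite E" using assms simple_graph_finite_edges by (auto simp: connected_graph_def)
  then have fin: "finite ?S"
    by (rule finite_subset[rotated, OF finite_Pow_iff[THEN iffD2]])
      (auto simp: is_spanning_tree_def)
  have ne: "?S \<noteq> {}" using ex_spanning_tree[OF assms] by simp
  have "Max (weight \<omega> ` ?S) \<in> weight \<omega> ` ?S" using fin ne by simp
  then obtain T where T: "T \<in> ?S" "weight \<omega> T = Max (weight \<omega> ` ?S)" by auto
  have "weight \<omega> T' \<le> weight \<omega> T" if "is_spanning_tree V E T'" for T'
    using that fin by (simp add: T(2))
  then show ?thesis using T(1) by (auto simp: is_max_spanning_tree_def)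
qed

lemma weighting_ratio_eq:
  assumes "is_max_spanning_tree V E \<omega> T"
  shows "weighting_ratio V E \<omega> = weight \<omega> T / weight \<omega> E"
proof -
  have "is_max_spanning_tree V E \<omega> (SOME T. is_max_spanning_tree V E \<omega> T)"
    using assms by (rule someI)
  then have "weight \<omega> (SOME T. is_max_spanning_tree V E \<omega> T) = weight \<omega> T"
    using assms unfolding is_max_spanning_tree_def by (meson order_antisym)
  then show ?thesis by (simp add: weighting_ratio_def)
qed

end

theory Submission
  imports Defs
begin

text \<open>Take a clique on \<open>m\<close> vertices in which every edge has weight \<open>1\<close>, and hang \<open>m choose 2\<close>
  pendant edges of weight \<open>0\<close> on one of its vertices. A spanning tree contains at most \<open>m - 1\<close>
  edges of the clique, so the weighting ratio is at most \<open>2 / m\<close>. The pendant edges, however,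
  bring the uniform ratio above \<open>1 / 2\<close>.\<close>

text \<open>The chord closes the initial segment of the path up to position \<open>j\<close>;
  \<open>2 \<le> j\<close> gives that segment the three vertices a cycle must have.\<close>

lemma ex_cycle_if_long_chord:
  assumes dist: "distinct xs" and path: "successively (\<lambda>x y. {x, y} \<in> E) xs"
    and j: "2 \<le> j" "j < length xs" and chord: "{xs ! 0, xs ! j} \<in> E"
  shows "is_cycle E (take (Suc j) xs)"
proof -
  have "{take (Suc j) xs ! i, take (Suc j) xs ! (Suc i mod Suc j)} \<in> E" if "i < Suc j" for i
  proof (cases "i = j")
    case True
    then show ?thesis using chord by (simp add: insert_commute)
  next
    case False
    then have "i < j" using that by simp
    then show ?thesis using path j by (simp add: successively_conv_nth)
  qed
  moreover have "length (take (Suc j) xs) = Suc j" using j by simp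
  ultimately show ?thesis using dist j by (simp add: is_cycle_def)
qed

text \<open>The first vertex of a longest path qualifies: by maximality all its neighbours lie on
  the path, and a neighbour beyond position \<open>1\<close> would close a cycle.\<close>

lemma ex_vertex_degree_le_1:
  assumes G: "simple_graph V E" and ne: "V \<noteq> {}" and acyc: "\<nexists>xs. is_cycle E xs"
  shows "\<exists>v\<in>V. card {e \<in> E. v \<in> e} \<le> 1"
proof -
  have finV: "finite V" and EV: "E \<subseteq> [V]\<^bsup>2\<^esup>" using G by (auto simp: simple_graph_def)
  define P where "P xs \<longleftrightarrow>
    xs \<noteq> [] \<and> distinct xs \<and> set xs \<subseteq> V \<and> successively (\<lambda>x y. {x, y} \<in> E) xs" for xs
  \<comment> \<open>This bound on path lengths is what guarantees that a longest path
    exists.\<close>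
  have bound: "length xs < Suc (card V)" if "P xs" for xs
    using that finV by (metis P_def card_mono distinct_card le_imp_less_Suc)
  obtain v0 where "v0 \<in> V" using ne by blast
  then have "P [v0]" by (simp add: P_def)
  then obtain xs where xs: "P xs" and max: "\<And>ys. P ys \<Longrightarrow> length ys \<le> length xs"
    using ex_has_greatest_nat[of P "[v0]" length "Suc (card V)"] bound by blast
  let ?x = "xs ! 0"
  have dist: "distinct xs" and sub: "set xs \<subseteq> V" and nxs: "xs \<noteq> []"
    and path: "successively (\<lambda>x y. {x, y} \<in> E) xs"
    using xs by (auto simp: P_def)
  have xV: "?x \<in> V" using nxs sub by (meson length_greater_0_conv nth_mem subsetD)
  have nbr: "e = {?x, xs ! 1}" if e: "e \<in> E" "?x \<in> e" for e
  proof -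
    have "e \<subseteq> V" "card e = 2" using e(1) EV by (auto simp: nsets_def)
    then obtain y where y: "e = {?x, y}" "y \<noteq> ?x" "y \<in> V"
      using e(2) by (auto simp: card_2_iff)
    have "y \<in> set xs"
    proof (rule ccontr)
      \<comment> \<open>A neighbour off the path could be prepended, giving a longer path.\<close>
      assume "y \<notin> set xs"
      then have "P (y # xs)"
        using xs y e(1) by (auto simp: P_def successively_Cons hd_conv_nth insert_commute)
      then show False using max by fastforce
    qed
    then obtain j where j: "j < length xs" "y = xs ! j" by (auto simp: in_set_conv_nth)
    have "j \<noteq> 0" using j(2) y(2) by metis
    moreover have "\<not> 2 \<le> j"
      using ex_cycle_if_long_chord[OF dist path _ j(1)] acyc e(1) y(1) j(2) by blast
    ultimately have "j = 1" by simp
    then show ?thesis using y(1) j(2) by simp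
  qed
  then have "{e \<in> E. ?x \<in> e} \<subseteq> {{?x, xs ! 1}}" by blast
  then have "card {e \<in> E. ?x \<in> e} \<le> 1" using card_mono[of "{{?x, xs ! 1}}"] by simp
  then show ?thesis using xV by blast
qed

lemma is_cycle_mono: "is_cycle E xs \<Longrightarrow> E \<subseteq> F \<Longrightarrow> is_cycle F xs"
  by (auto simp: is_cycle_def)

text \<open>Induction on the number of vertices: deleting a vertex of degree at most one loses at
  most one edge. The bound covers forests because it is applied to the part of a spanning tree
  inside the clique, which may be disconnected.\<close>

lemma acyclic_card_edges_less:
  assumes "simple_graph V E" "V \<noteq> {}" "\<nexists>xs. is_cycle E xs"
  shows "card E < card V"
  using assms
proof (induction "card V" arbitrary: V E rule: less_induct)
  case less
  have finV: "finite V" and EV: "E \<subseteq> [V]\<^bsup>2\<^esup>"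
    using less.prems(1) by (auto simp: simple_graph_def)
  obtain v where v: "v \<in> V" "card {e \<in> E. v \<in> e} \<le> 1"
    using ex_vertex_degree_le_1[OF less.prems] by blast
  let ?E = "{e \<in> E. v \<notin> e}"
  have cardV: "card V = Suc (card (V - {v}))" using finV v(1) by (simp only: card_Suc_Diff1)
  have sub: "?E \<subseteq> [V - {v}]\<^bsup>2\<^esup>" using EV by (auto simp: nsets_def)
  have "?E \<union> {e \<in> E. v \<in> e} = E" by blast
  then have cardE: "card E \<le> card ?E + 1"
    using card_Un_le[of ?E "{e \<in> E. v \<in> e}"] v(2) by simp
  show ?case
  proof (cases "V - {v} = {}")
    \<comment> \<open>The induction hypothesis speaks of nonempty vertex sets, so a single vertex is
      treated directly: it carries no edge.\<close>
    case True
    have "E = {}"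
    proof (rule ccontr)
      assume "E \<noteq> {}"
      then obtain e where e: "e \<subseteq> V" "card e = 2" using EV by (auto simp: nsets_def)
      have "card e \<le> card V" using e(1) finV by (simp add: card_mono)
      then show False using e(2) cardV True by simp
    qed
    then show ?thesis using cardV by simp
  next
    case False
    have "card ?E < card (V - {v})"
    proof (rule less.hyps)
      show "simple_graph (V - {v}) ?E" using finV sub by (simp add: simple_graph_def)
      show "\<nexists>xs. is_cycle ?E xs" using less.prems(3) is_cycle_mono[of ?E _ E] by blast
    qed (use cardV False in auto)
    then show ?thesis using cardE cardV by simp
  qed
qed

lemma connected_graph_if_dominating_vertex:
  assumes "simple_graph V E" "r \<in> V" "\<And>v. v \<in> V \<Longrightarrow> v \<noteq> r \<Longrightarrow> {r, v} \<in> E"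
  shows "connected_graph V E"
proof -
  have fwd: "(r, v) \<in> (adjacency E)\<^sup>*" if "v \<in> V" for v
    using assms(3)[OF that] by (cases "v = r") (auto simp: adjacency_def)
  then have "(v, r) \<in> (adjacency E)\<^sup>*" if "v \<in> V" for v
    using that by (meson sym_adjacency sym_rtrancl symD)
  then show ?thesis
    using assms(1,2) fwd unfolding connected_graph_def by (metis empty_iff rtrancl_trans)
qed

theorem theorem1:
  fixes \<epsilon> :: real
  assumes "\<epsilon> > 0"
  shows "\<exists>(V :: nat set) (E :: nat set set) (\<omega> :: nat set \<Rightarrow> real).
           connected_graph V E \<and> (\<forall>e\<in>E. 0 \<le> \<omega> e) \<and> weight \<omega> E > 0 \<and>
           weighting_ratio V E \<omega> / uniform_ratio V E < \<epsilon>"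
proof -
  \<comment> \<open>The quotient of the two ratios will be at most \<open>4 / real m\<close>. Adding
    \<open>2\<close> to \<open>k\<close> ensures that the clique has an edge.\<close>
  obtain k :: nat where k: "4 / \<epsilon> < real k" using reals_Archimedean2 by blast
  define m where "m = k + 2"
  have m: "2 \<le> m" and m\<epsilon>: "4 / real m < \<epsilon>"
    using k assms by (auto simp: m_def field_simps)
  define c where "c = m choose 2"
  define V :: "nat set" where "V = {..<m + c}"
  define K :: "nat set set" where "K = [{..<m}]\<^bsup>2\<^esup>"
  \<comment> \<open>All pendant edges hang on the clique vertex \<open>0\<close>, which is thereby
    adjacent to every other vertex; connectedness follows.\<close>
  define S where "S = (\<lambda>i. {0::nat, i}) ` {m..<m + c}"
  define E where "E = K \<union> S"
  define \<omega> :: "nat set \<Rightarrow> real" where "\<omega> e = (if e \<in> K then 1 else 0)" for e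
  have finK: "finite K" by (simp add: K_def finite_imp_finite_nsets)
  have cardK: "card K = c" by (simp add: K_def c_def)
  \<comment> \<open>Parity makes the integer division in \<open>choose_two\<close> exact.\<close>
  have "even (m * (m - 1))" by (simp add: m_def)
  then have "2 * c = m * (m - 1)" by (simp add: c_def choose_two)
  then have "real (2 * c) = real (m * (m - 1))" by (simp only:)
  then have c: "2 * real c = real m * (real m - 1)" using m by simp
  have cpos: "c > 0" using m unfolding c_def by (rule zero_less_binomial)
  have finE: "finite E" using finK by (simp add: E_def S_def)
  have simple: "simple_graph V E"
    using m by (auto simp: simple_graph_def V_def E_def K_def S_def nsets_def)
  have con: "connected_graph V E"
  proof (rule connected_graph_if_dominating_vertex[OF simple])
    show "0 \<in> V" using m by (simp add: V_def)
    show "{0, v} \<in> E" if "v \<in> V" "v \<noteq> 0" for v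
      using that m by (cases "v < m") (auto simp: V_def E_def K_def S_def nsets_def)
  qed
  have weight_eq: "weight \<omega> F = card (F \<inter> K)" if "finite F" for F
    using that by (simp add: weight_def \<omega>_def sum.If_cases)
  have wE: "weight \<omega> E = c"
    using weight_eq[OF finE] cardK by (simp add: E_def Int_absorb1)
  obtain T where T: "is_max_spanning_tree V E \<omega> T" using ex_max_spanning_tree[OF con] by blast
  then have TE: "T \<subseteq> E" and acyc: "\<nexists>xs. is_cycle T xs"
    by (auto simp: is_max_spanning_tree_def is_spanning_tree_def is_tree_def)
  \<comment> \<open>Only clique edges have weight, and those in \<open>T\<close> form a forest on
    the \<open>m\<close> clique vertices.\<close>
  have "card (T \<inter> K) < card {..<m}"
  proof (rule acyclic_card_edges_less)
    show "simple_graph {..<m} (T \<inter> K)" by (auto simp: simple_graph_def K_def)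
    show "\<nexists>xs. is_cycle (T \<inter> K) xs" using acyc is_cycle_mono[of "T \<inter> K" _ T] by blast
  qed (use m in \<open>auto simp: lessThan_empty_iff\<close>)
  then have wT: "weight \<omega> T \<le> real m - 1"
    using weight_eq[of T] finite_subset[OF TE finE] by simp
  \<comment> \<open>\<open>card E\<close> ends up in the numerator of the quotient, so it has to be
    bounded from above.\<close>
  have "card S \<le> c" using card_image_le[of "{m..<m + c}"] by (simp add: S_def)
  then have cardE: "real (card E) \<le> 2 * real c"
    using card_Un_le[of K S] cardK by (simp add: E_def)
  have cardV: "real c \<le> real (card V) - 1" using m by (simp add: V_def)
  have "weighting_ratio V E \<omega> / uniform_ratio V E
      = weight \<omega> T / real c * (real (card E) / (real (card V) - 1))"
    by (simp add: weighting_ratio_eq[OF T] wE uniform_ratio_def)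
  also have "\<dots> \<le> (real m - 1) / real c * (2 * real c / real c)"
    using wT cardE cardV cpos m
    by (intro mult_mono divide_right_mono frac_le) auto
  \<comment> \<open>Substituting \<open>2 * real c = real m * (real m - 1)\<close> cancels the
    factor \<open>real m - 1\<close>.\<close>
  also have "\<dots> = 4 / real m"
    using c cpos m by (simp add: field_simps)
  also have "\<dots> < \<epsilon>" by (rule m\<epsilon>)
  finally have "weighting_ratio V E \<omega> / uniform_ratio V E < \<epsilon>" .
  then show ?thesis
    using con wE cpos by (intro exI[of _ V] exI[of _ E] exI[of _ \<omega>]) (auto simp: \<omega>_def)
qed

end
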